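(* Every sequence $(x_k)_{k\in\mathbb{N}}$ generated by the implementable version of tPLDCA satisfies: (a) the sequence $\left(f(x_k)+\left(\frac{\gamma}{2}+\rho\right)\|x_k-x_{k-1}\|^2\right)_{k\in\mathbb{N}}$ is decreasing; (b) $\lim_{k\to+\infty}\|x_{k+1}-x_k\|=0$; (c) $(f(x_k))_{k\in\mathbb{N}}$ is convergent. Moreover, if there exists a cluster point $\bar x$ of $(x_k)_{k\in\mathbb{N}}$, then: (d) $\lim_{k\to+\infty}f(x_k)=f(\bar x)$; (e) $\bar x$ is a critical point of $f$, i.e. $\partial g(\bar x)\cap\partial h(\bar x)\neq\emptyset$.
   Context: "Decreasing" is meant in the non-strict sense (each term is $\ge$ the next). Notation: $\mathbb{N}=\{0,1,2,\dots\}$; $\langle\cdot,\cdot\rangle$ and $\|\cdot\|$ are the inner product and Euclidean norm on $\mathbb{R}^n$. $\Gamma_0(\mathbb{R}^n)$ is the set of proper, lower semicontinuous, convex functions $\mathbb{R}^n\to\mathbb{R}\cup\{+\infty\}$; $\mathrm{dom}\,\phi=\{x:\phi(x)<+\infty\}$. For $\phi\in\Gamma_0(\mathbb{R}^n)$, $x\in\mathrm{dom}\,\phi$, $\epsilon>0$: $\partial\phi(x)=\{s:\phi(y)\ge\phi(x)+\langle s,y-x\rangle\ \forall y\in\mathbb{R}^n\}$ and $\partial_\epsilon\phi(x)=\{s:\phi(y)\ge\phi(x)+\langle s,y-x\rangle-\epsilon\ \forall y\in\mathbb{R}^n\}$; for $\epsilon=0$, $\partial_0\phi=\partial\phi$.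 For a nonempty closed set $S$, $\mathrm{dist}(x,S)=\min_{y\in S}\|x-y\|$. Standing assumptions: $g,h\in\Gamma_0(\mathbb{R}^n)$, $f=g-h$, and (1) $\inf_{x\in\mathbb{R}^n} f(x)>-\infty$; (2) $\mathrm{dom}\,h=\mathbb{R}^n$; (3) $g(x)=\max\{g_1(x),\dots,g_p(x)\}$ for all $x\in\mathbb{R}^n$, where $p\ge1$ and $g_1,\dots,g_p:\mathbb{R}^n\to\mathbb{R}$ are smooth (continuously differentiable) convex functions (so $\mathrm{dom}\,g=\mathbb{R}^n$); (4) there is an inner iterative algorithm $T_g$ such that for any $(x_k,u_k,\lambda_k)\in\mathrm{dom}\,g\times\mathbb{R}^n\times(0,\infty)$, $T_g(x_k,u_k,\lambda_k)$ generates a sequence $(z_i)_{i\in\mathbb{N}}$ in $\mathrm{dom}\,g$ converging to a solution $\bar z_k$ of the proximal point subproblem (PP): minimize over $z\in\mathbb{R}^n$ the function $\tilde f_k(z)=g(z)-\langle u_k,z-x_k\rangle+\frac{1}{2\lambda_k}\|z-x_k\|^2$; i.e. $0\in\partial\tilde f_k(\bar z_k)=\partial g(\bar z_k)-u_k+\frac{1}{\lambda_k}(\bar z_k-x_k)$. $\epsilon$-strict subdifferential: for $x\in\mathbb{R}^n$, $\epsilon\ge0$, $\hat\partial_\epsilon g(x)=\mathrm{Conv}\{\nabla g_i(x): i\in I_{g,\epsilon}(x)\}$ (convex hull), where $I_{g,\epsilon}(x)=\{i\in\{1,\dots,p\}: g_i(x)\ge g(x)-\epsilon\}$. Implementable version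 of tPLDCA (Algorithm 3 of the paper). Parameters: $\sigma\in(0,1)$, $\lambda>0$, $\theta>\frac1\lambda$, $\rho\in[0,\frac{1-\sigma}{\lambda})$, $\gamma\in[0,\frac{1-\sigma}{\lambda}-\rho)$, $\lambda_k=\lambda$ for all $k\in\mathbb{N}$, and positive numbers $(\zeta_k)_{k\in\mathbb{N}}$ with $\zeta_k\to0$. Start with $x_{-1},x_0\in\mathrm{dom}\,f=\{x:f(x)<+\infty\}$ and for $k=0,1,2,\dots$ do: Step 1: find $u_k\in\mathbb{R}^n$ with $\mathrm{dist}(u_k,\partial_{\epsilon_k}h(x_k))\le d_k$, where $\epsilon_k=\rho\|x_k-x_{k-1}\|^2$ and $d_k=\gamma\|x_k-x_{k-1}\|$. Step 2: set $z_{-1}=x_k$ and generate $z_0,z_1,\dots$ by $T_g(x_k,u_k,\lambda_k)$ until, for some $i\in\{-1\}\cup\mathbb{N}$, both $g(x_k)-g(z_i)-\langle u_k,x_k-z_i\rangle\ge\frac{1-\sigma}{\lambda}\|z_i-x_k\|^2$ and $\mathrm{dist}(u_k,\hat\partial_{\zeta_k}g(z_i))\le\theta\|z_i-x_k\|$ hold; then set $x_{k+1}=z_i$. *)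

theory Defs
  imports "HOL-Analysis.Analysis"
begin

section \<open>Convex analysis for extended-real-valued functions\<close>

definition effective_domain :: "('a \<Rightarrow> ereal) \<Rightarrow> 'a set" where
  "effective_domain \<phi> = {x. \<phi> x < \<infinity>}"

definition proper_fun :: "('a \<Rightarrow> ereal) \<Rightarrow> bool" where
  "proper_fun \<phi> \<longleftrightarrow> (\<forall>x. \<phi> x \<noteq> -\<infinity>) \<and> effective_domain \<phi> \<noteq> {}"

definition lower_semicontinuous :: "('a::topological_space \<Rightarrow> ereal) \<Rightarrow> bool" where
  "lower_semicontinuous \<phi> \<longleftrightarrow> (\<forall>x. \<phi> x \<le> Liminf (at x) \<phi>)"

text \<open>The constant \<^const>\<open>convex_on\<close> is for real-valued functions only. The inequality below is
  meaningful for functions that omit \<open>-\<infinity>\<close>.\<close>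

definition ereal_convex :: "('a::real_vector \<Rightarrow> ereal) \<Rightarrow> bool" where
  "ereal_convex \<phi> \<longleftrightarrow>
     (\<forall>x y. \<forall>t\<in>{0<..<1::real}.
        \<phi> ((1 - t) *\<^sub>R x + t *\<^sub>R y) \<le> ereal (1 - t) * \<phi> x + ereal t * \<phi> y)"

definition Gamma0 :: "('a::euclidean_space \<Rightarrow> ereal) set" where
  "Gamma0 = {\<phi>. proper_fun \<phi> \<and> lower_semicontinuous \<phi> \<and> ereal_convex \<phi>}"

definition subdifferential :: "('a::real_inner \<Rightarrow> ereal) \<Rightarrow> 'a \<Rightarrow> 'a set" where
  "subdifferential \<phi> x = {s. \<forall>y. \<phi> y \<ge> \<phi> x + ereal (s \<bullet> (y - x))}"

definition eps_subdifferential :: "real \<Rightarrow> ('a::real_inner \<Rightarrow> ereal) \<Rightarrow> 'a \<Rightarrow> 'a set" where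
  "eps_subdifferential \<epsilon> \<phi> x = {s. \<forall>y. \<phi> y \<ge> \<phi> x + ereal (s \<bullet> (y - x)) - ereal \<epsilon>}"

lemma eps_subdifferential_0: "eps_subdifferential 0 \<phi> x = subdifferential \<phi> x"
  by (simp add: eps_subdifferential_def subdifferential_def flip: zero_ereal_def)

definition critical_point :: "('a::real_inner \<Rightarrow> ereal) \<Rightarrow> ('a \<Rightarrow> ereal) \<Rightarrow> 'a \<Rightarrow> bool" where
  "critical_point g h x \<longleftrightarrow> subdifferential g x \<inter> subdifferential h x \<noteq> {}"

definition cluster_point :: "'a::topological_space \<Rightarrow> (nat \<Rightarrow> 'a) \<Rightarrow> bool" where
  "cluster_point l x \<longleftrightarrow> (\<exists>r. strict_mono r \<and> (x \<circ> r) \<longlonglongrightarrow> l)"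


section \<open>Finite maxima of smooth functions\<close>

definition gradient :: "('a::real_inner \<Rightarrow> real) \<Rightarrow> 'a \<Rightarrow> 'a" where
  "gradient \<phi> x = (THE D. GDERIV \<phi> x :> D)"

definition continuously_differentiable :: "('a::real_inner \<Rightarrow> real) \<Rightarrow> bool" where
  "continuously_differentiable \<phi> \<longleftrightarrow>
     (\<forall>x. \<exists>D. GDERIV \<phi> x :> D) \<and> continuous_on UNIV (gradient \<phi>)"

definition eps_active ::
    "nat \<Rightarrow> (nat \<Rightarrow> 'a \<Rightarrow> real) \<Rightarrow> ('a \<Rightarrow> ereal) \<Rightarrow> real \<Rightarrow> 'a \<Rightarrow> nat set" where
  "eps_active p G g \<epsilon> x = {i\<in>{1..p}. ereal (G i x) \<ge> g x - ereal \<epsilon>}"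

definition strict_eps_subdifferential ::
    "nat \<Rightarrow> (nat \<Rightarrow> 'a::real_inner \<Rightarrow> real) \<Rightarrow> ('a \<Rightarrow> ereal) \<Rightarrow> real \<Rightarrow> 'a \<Rightarrow> 'a set" where
  "strict_eps_subdifferential p G g \<epsilon> x =
     convex hull {gradient (G i) x | i. i \<in> eps_active p G g \<epsilon> x}"


section \<open>The algorithm\<close>

definition prox_objective ::
    "('a::real_inner \<Rightarrow> ereal) \<Rightarrow> 'a \<Rightarrow> 'a \<Rightarrow> real \<Rightarrow> 'a \<Rightarrow> ereal" where
  "prox_objective g x u lam z =
     g z - ereal (u \<bullet> (z - x)) + ereal (1 / (2 * lam) * (norm (z - x))\<^sup>2)"

definition inner_algorithm ::
    "('a::euclidean_space \<Rightarrow> ereal) \<Rightarrow> ('a \<Rightarrow> 'a \<Rightarrow> real \<Rightarrow> nat \<Rightarrow> 'a) \<Rightarrow> bool" where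
  "inner_algorithm g T \<longleftrightarrow>
     (\<forall>x\<in>effective_domain g. \<forall>u. \<forall>lam>0.
        (\<forall>i. T x u lam i \<in> effective_domain g) \<and>
        (\<exists>zbar. T x u lam \<longlonglongrightarrow> zbar \<and>
           (\<forall>z. prox_objective g x u lam zbar \<le> prox_objective g x u lam z)))"

text \<open>Inner iterates are indexed by the integers \<open>i \<ge> -1\<close>, with the current point placed at \<open>-1\<close>.\<close>

definition inner_iterate ::
    "('a \<Rightarrow> 'a \<Rightarrow> real \<Rightarrow> nat \<Rightarrow> 'a) \<Rightarrow> 'a \<Rightarrow> 'a \<Rightarrow> real \<Rightarrow> int \<Rightarrow> 'a" where
  "inner_iterate T x u lam i = (if i = -1 then x else T x u lam (nat i))"

definition stop_test ::
    "nat \<Rightarrow> (nat \<Rightarrow> 'a::euclidean_space \<Rightarrow> real) \<Rightarrow> ('a \<Rightarrow> ereal) \<Rightarrow> real \<Rightarrow> real \<Rightarrow> real \<Rightarrow>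
     real \<Rightarrow> 'a \<Rightarrow> 'a \<Rightarrow> 'a \<Rightarrow> bool" where
  "stop_test p G g \<sigma> lam \<theta> \<zeta> x u z \<longleftrightarrow>
     g x - g z - ereal (u \<bullet> (x - z)) \<ge> ereal ((1 - \<sigma>) / lam * (norm (z - x))\<^sup>2) \<and>
     infdist u (strict_eps_subdifferential p G g \<zeta> z) \<le> \<theta> * norm (z - x)"

text \<open>Outer iterates are indexed by the integers \<open>k \<ge> -1\<close>; values at smaller indices are irrelevant.
  The inner loop stops at the first inner iterate that passes the test. Since \<^const>\<open>infdist\<close> to the
  empty set is \<open>0\<close>, the distance conditions have their usual meaning only because the two sets
  involved are nonempty when \<open>h\<close> is finite and convex and \<open>g\<close> is the maximum of the \<open>G i\<close>.\<close>

definition tPLDCA_generated ::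
    "nat \<Rightarrow> (nat \<Rightarrow> 'a::euclidean_space \<Rightarrow> real) \<Rightarrow> ('a \<Rightarrow> ereal) \<Rightarrow> ('a \<Rightarrow> ereal) \<Rightarrow>
     ('a \<Rightarrow> 'a \<Rightarrow> real \<Rightarrow> nat \<Rightarrow> 'a) \<Rightarrow>
     real \<Rightarrow> real \<Rightarrow> real \<Rightarrow> real \<Rightarrow> real \<Rightarrow> (nat \<Rightarrow> real) \<Rightarrow> (int \<Rightarrow> 'a) \<Rightarrow> bool" where
  "tPLDCA_generated p G g h T \<sigma> lam \<theta> \<rho> \<gamma> \<zeta> x \<longleftrightarrow>
     x (-1) \<in> effective_domain (\<lambda>y. g y - h y) \<and>
     x 0 \<in> effective_domain (\<lambda>y. g y - h y) \<and>
     (\<exists>u :: nat \<Rightarrow> 'a. \<forall>k :: nat.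
        infdist (u k)
          (eps_subdifferential (\<rho> * (norm (x (int k) - x (int k - 1)))\<^sup>2) h (x (int k)))
          \<le> \<gamma> * norm (x (int k) - x (int k - 1)) \<and>
        (\<exists>i\<ge>-1.
           stop_test p G g \<sigma> lam \<theta> (\<zeta> k) (x (int k)) (u k)
             (inner_iterate T (x (int k)) (u k) lam i) \<and>
           (\<forall>j. -1 \<le> j \<and> j < i \<longrightarrow>
              \<not> stop_test p G g \<sigma> lam \<theta> (\<zeta> k) (x (int k)) (u k)
                  (inner_iterate T (x (int k)) (u k) lam j)) \<and>
           x (int k + 1) = inner_iterate T (x (int k)) (u k) lam i))"

end

theory Submission
  imports Defs
begin

text \<open>Testing the stopping criterion against an \<open>\<epsilon>\<close>-subgradient of \<open>h\<close> close to \<open>u\<close> makes the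
  energy drop by at least a fixed multiple of the squared step length, which gives the statements
  about the whole sequence. Along a subsequence tending to a cluster point, the \<open>\<epsilon>\<close>-subgradients
  of \<open>h\<close> at \<open>x k\<close> are bounded, so a further subsequence of them converges. The \<open>\<zeta>\<close>-subgradients of
  \<open>g\<close> at \<open>x (k + 1)\<close> provided by the stopping criterion have the same limit, and closedness of
  the graphs puts this limit in both subdifferentials.\<close>

section \<open>Approximate subgradients of finite-valued functions\<close>

lemma eps_subdifferential_ereal_iff:
  "s \<in> eps_subdifferential e (\<lambda>y. ereal (H y)) x \<longleftrightarrow> (\<forall>y. H x + s \<bullet> (y - x) - e \<le> H y)"
  by (simp add: eps_subdifferential_def)

lemma closed_eps_subdifferential_ereal:
  "closed (eps_subdifferential e (\<lambda>y. ereal (H y)) x)"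
proof -
  have "eps_subdifferential e (\<lambda>y. ereal (H y)) x = (\<Inter>y. {s. H x + s \<bullet> (y - x) - e \<le> H y})"
    by (auto simp: eps_subdifferential_ereal_iff)
  moreover have "closed {s. H x + s \<bullet> (y - x) - e \<le> H y}" for y
    by (intro closed_Collect_le continuous_intros)
  ultimately show ?thesis by auto
qed

lemma convex_eps_subdifferential_ereal:
  "convex (eps_subdifferential e (\<lambda>y. ereal (H y)) x)"
proof -
  have "eps_subdifferential e (\<lambda>y. ereal (H y)) x = (\<Inter>y. {s. (y - x) \<bullet> s \<le> H y - H x + e})"
    by (auto simp: eps_subdifferential_ereal_iff inner_commute algebra_simps)
  then show ?thesis
    by (simp add: convex_INT convex_halfspace_le)
qed

text \<open>The subgradient is the slope of a hyperplane separating the epigraph from the open vertical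
  ray below the point of the graph.\<close>

lemma convex_on_UNIV_subgradient_exists:
  fixes H :: "'a::euclidean_space \<Rightarrow> real"
  assumes "convex_on UNIV H"
  shows "\<exists>s. \<forall>y. H x + s \<bullet> (y - x) \<le> H y"
proof -
  define E where "E = epigraph UNIV H"
  define R where "R = {x} \<times> {..<H x}"
  have "convex E" "convex R"
    using assms by (auto simp: E_def R_def convex_epigraph convex_Times)
  moreover have "E \<noteq> {}" "R \<noteq> {}" "R \<inter> E = {}"
    using lt_ex[of "H x"] by (auto simp: E_def R_def epigraph_def)
  ultimately obtain a b where "a \<noteq> 0" and R: "\<forall>z\<in>R. a \<bullet> z \<le> b" and E: "\<forall>z\<in>E. a \<bullet> z \<ge> b"
    using separating_hyperplane_sets[of R E] by blast
  obtain v c where a: "a = (v, c)" by force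
  have below: "v \<bullet> x + c * t \<le> b" if "t < H x" for t
    using R that by (auto simp: R_def a)
  have above: "b \<le> v \<bullet> y + c * t" if "H y \<le> t" for y t
    using E that by (auto simp: E_def epigraph_def a)
  have "c \<ge> 0"
    using below[of "H x - 1"] above[of x "H x"] by (simp add: algebra_simps)
  \<comment> \<open>The hyperplane cannot be vertical: \<open>H\<close> is finite everywhere, so the
    epigraph has points above \<open>x - v\<close>, and comparing these with the ray would force
    \<open>v = 0\<close>.\<close>
  moreover have "c \<noteq> 0"
  proof
    assume "c = 0"
    then have "v \<bullet> v \<le> 0"
      using below[of "H x - 1"] above[of "x - v" "H (x - v)"] by (simp add: inner_diff_right)
    then have "v = 0"
      by (metis inner_eq_zero_iff inner_ge_zero order_antisym)
    with \<open>a \<noteq> 0\<close> \<open>c = 0\<close> show False by (simp add: a zero_prod_def)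
  qed
  ultimately have "c > 0" by simp
  \<comment> \<open>The ray omits its endpoint. Going down by \<open>e / c\<close> costs exactly
    \<open>e\<close> after multiplication by \<open>c\<close>, and \<open>e\<close> is
    arbitrary.\<close>
  have "v \<bullet> x + c * H x \<le> b"
  proof (rule field_le_epsilon)
    fix e :: real assume "e > 0"
    then show "v \<bullet> x + c * H x \<le> b + e"
      using below[of "H x - e / c"] \<open>c > 0\<close> by (simp add: algebra_simps)
  qed
  then have "c * H x - v \<bullet> (y - x) \<le> c * H y" for y
    using above[of y "H y"] by (simp add: inner_diff_right)
  then have "H x + (- (1 / c) *\<^sub>R v) \<bullet> (y - x) \<le> H y" for y
    using \<open>c > 0\<close> by (simp add: field_simps)
  then show ?thesis by blast
qed

text \<open>Any exact subgradient qualifies. Since \<open>infdist\<close> to the empty set is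
  \<open>0\<close>, nonemptiness is what gives the distance condition on \<open>u\<close> its
  content.\<close>

lemma eps_subdifferential_ereal_nonempty:
  fixes H :: "'a::euclidean_space \<Rightarrow> real"
  assumes "convex_on UNIV H" and "e \<ge> 0"
  shows "eps_subdifferential e (\<lambda>y. ereal (H y)) x \<noteq> {}"
proof -
  obtain s where s: "\<And>y. H x + s \<bullet> (y - x) \<le> H y"
    using convex_on_UNIV_subgradient_exists[OF assms(1)] by blast
  have "H x + s \<bullet> (y - x) - e \<le> H y" for y
    using s[of y] assms(2) by simp
  then show ?thesis
    using eps_subdifferential_ereal_iff by blast
qed

text \<open>Nonempty closed sets contain nearest points. This turns the \<open>infdist\<close>
  conditions of the algorithm into concrete approximate subgradients.\<close>

lemma ex_dist_le_of_infdist_le: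
  fixes S :: "'a::heine_borel set"
  assumes "infdist u S \<le> d" "closed S" "S \<noteq> {}"
  obtains s where "s \<in> S" "dist u s \<le> d"
  using infdist_attains_inf[OF assms(2,3), of u] assms(1) by metis

text \<open>Properness and full domain exclude both infinite values, and a finite convex function on
  a finite-dimensional space is continuous.\<close>

lemma Gamma0_finite_valued:
  assumes "\<phi> \<in> Gamma0" and "effective_domain \<phi> = UNIV"
  obtains H where "\<phi> = (\<lambda>y. ereal (H y))" "convex_on UNIV H" "continuous_on UNIV H"
proof -
  define H where "H = (\<lambda>y. real_of_ereal (\<phi> y))"
  have "\<bar>\<phi> y\<bar> \<noteq> \<infinity>" for y
    using assms by (auto simp: Gamma0_def proper_fun_def effective_domain_def)
  then have \<phi>: "\<phi> = (\<lambda>y. ereal (H y))"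
    by (simp add: H_def ereal_real')
  have "ereal_convex \<phi>"
    using assms(1) by (simp add: Gamma0_def)
  then have cvx: "convex_on UNIV H"
    by (intro convex_onI) (auto simp: ereal_convex_def \<phi>)
  moreover have "continuous_on UNIV H"
    using cvx by (intro convex_on_continuous) auto
  ultimately show ?thesis
    using that \<phi> by blast
qed

text \<open>Some subgradient exists, and subtracting it leaves a function minimized at \<open>x\<close>, so the
  gradient must agree with it.\<close>

lemma convex_on_UNIV_gradient_ineq:
  fixes \<phi> :: "'a::euclidean_space \<Rightarrow> real"
  assumes "convex_on UNIV \<phi>" and "GDERIV \<phi> x :> D"
  shows "\<phi> x + gradient \<phi> x \<bullet> (y - x) \<le> \<phi> y"
proof -
  obtain s where s: "\<And>y. \<phi> x + s \<bullet> (y - x) \<le> \<phi> y"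
    using convex_on_UNIV_subgradient_exists[OF assms(1)] by blast
  \<comment> \<open>\<open>gradient\<close> is a definite description, so every candidate
    \<open>D'\<close>, not only \<open>D\<close>, has to equal \<open>s\<close>.\<close>
  have unique: "D' = s" if "GDERIV \<phi> x :> D'" for D'
  proof -
    have "((\<lambda>y. \<phi> y - s \<bullet> y) has_derivative (\<lambda>v. v \<bullet> D' - s \<bullet> v)) (at x)"
      using that unfolding gderiv_def by (auto intro!: derivative_eq_intros)
    then have "(\<lambda>v. v \<bullet> D' - s \<bullet> v) = (\<lambda>v. 0)"
      by (rule differential_zero_maxmin[where S = UNIV, rotated 2])
        (use s in \<open>auto simp: algebra_simps\<close>)
    \<comment> \<open>The direction \<open>D' - s\<close> turns the vanishing derivative into a
      vanishing squared norm.\<close>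
    from fun_cong[OF this, of "D' - s"] have "(D' - s) \<bullet> (D' - s) = 0"
      by (simp add: inner_diff_right inner_diff_left inner_commute)
    then show ?thesis by simp
  qed
  have "gradient \<phi> x = s"
    unfolding gradient_def using unique[OF assms(2)] assms(2)
    by (intro the_equality unique) auto
  with s show ?thesis by simp
qed

section \<open>The \<epsilon>-strict subdifferential of a finite maximum\<close>

lemma strict_eps_subdifferential_subset:
  fixes G :: "nat \<Rightarrow> 'a::euclidean_space \<Rightarrow> real"
  assumes "\<And>i. i \<in> {1..p} \<Longrightarrow> convex_on UNIV (G i)"
    and "\<And>i. i \<in> {1..p} \<Longrightarrow> continuously_differentiable (G i)"
    and "\<And>i y. i \<in> {1..p} \<Longrightarrow> G i y \<le> M y"
  shows "strict_eps_subdifferential p G (\<lambda>y. ereal (M y)) e x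
    \<subseteq> eps_subdifferential e (\<lambda>y. ereal (M y)) x"
  unfolding strict_eps_subdifferential_def
proof (rule hull_minimal)
  \<comment> \<open>The tangent of \<open>G i\<close> lies below \<open>G i\<close>, hence below
    \<open>M\<close>, and activity bounds its gap to \<open>M\<close> at \<open>x\<close> by
    \<open>e\<close>.\<close>
  have "M x + gradient (G i) x \<bullet> (y - x) - e \<le> M y"
    if "i \<in> eps_active p G (\<lambda>y. ereal (M y)) e x" for i y
  proof -
    have i: "i \<in> {1..p}" and active: "M x - e \<le> G i x"
      using that by (auto simp: eps_active_def)
    obtain D where "GDERIV (G i) x :> D"
      using assms(2)[OF i] by (auto simp: continuously_differentiable_def)
    then have "G i x + gradient (G i) x \<bullet> (y - x) \<le> G i y"
      by (rule convex_on_UNIV_gradient_ineq[OF assms(1)[OF i]])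
    with active assms(3)[OF i, of y] show ?thesis by simp
  qed
  then show "{gradient (G i) x |i. i \<in> eps_active p G (\<lambda>y. ereal (M y)) e x}
      \<subseteq> eps_subdifferential e (\<lambda>y. ereal (M y)) x"
    by (auto simp: eps_subdifferential_ereal_iff)
qed (rule convex_eps_subdifferential_ereal)

text \<open>The hull of finitely many points is compact; closedness lets the distance in the
  stopping test be attained.\<close>

lemma closed_strict_eps_subdifferential:
  fixes G :: "nat \<Rightarrow> 'a::euclidean_space \<Rightarrow> real"
  shows "closed (strict_eps_subdifferential p G g e x)"
proof -
  have "finite {gradient (G i) x |i. i \<in> eps_active p G g e x}"
    by (simp add: eps_active_def)
  then show ?thesis
    unfolding strict_eps_subdifferential_def
    by (intro compact_imp_closed compact_convex_hull finite_imp_compact)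
qed

text \<open>An index attaining the maximum is active for every nonnegative tolerance.\<close>

lemma strict_eps_subdifferential_nonempty:
  assumes "p \<ge> 1" and "e \<ge> 0" and "g x = ereal (Max ((\<lambda>i. G i x) ` {1..p}))"
  shows "strict_eps_subdifferential p G g e x \<noteq> {}"
proof -
  have "Max ((\<lambda>i. G i x) ` {1..p}) \<in> (\<lambda>i. G i x) ` {1..p}"
    using assms(1) by (intro Max_in) auto
  then obtain i where i: "i \<in> {1..p}" "G i x = Max ((\<lambda>i. G i x) ` {1..p})"
    by auto
  have "i \<in> eps_active p G g e x"
    using i assms(2) unfolding eps_active_def assms(3) by simp
  then show ?thesis
    by (auto simp: strict_eps_subdifferential_def)
qed

section \<open>Limits and bounds of approximate subgradients\<close>

lemma eps_subgradients_limit: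
  fixes H :: "'a::real_inner \<Rightarrow> real"
  assumes H: "continuous_on UNIV H"
    and X: "X \<longlonglongrightarrow> x" and S: "S \<longlonglongrightarrow> s" and e: "e \<longlonglongrightarrow> 0"
    and "\<And>k. S k \<in> eps_subdifferential (e k) (\<lambda>y. ereal (H y)) (X k)"
  shows "s \<in> subdifferential (\<lambda>y. ereal (H y)) x"
proof -
  have HX: "(\<lambda>k. H (X k)) \<longlonglongrightarrow> H x"
    using X H by (auto intro: continuous_on_tendsto_compose)
  have "H x + s \<bullet> (y - x) - 0 \<le> H y" for y
  proof (rule LIMSEQ_le_const2)
    show "(\<lambda>k. H (X k) + S k \<bullet> (y - X k) - e k) \<longlonglongrightarrow> H x + s \<bullet> (y - x) - 0"
      by (intro tendsto_intros HX X S e)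
    show "\<exists>N. \<forall>k\<ge>N. H (X k) + S k \<bullet> (y - X k) - e k \<le> H y"
      using assms(5) by (auto simp: eps_subdifferential_ereal_iff)
  qed
  then show ?thesis
    by (simp add: eps_subdifferential_ereal_iff flip: eps_subdifferential_0)
qed

text \<open>A unit step in the direction of \<open>S k\<close> raises the affine minorant by
  \<open>norm (S k)\<close>, while \<open>H\<close> is bounded on a ball containing every
  \<open>X k\<close> and its unit neighbourhood.\<close>

lemma bounded_eps_subgradients:
  fixes H :: "'a::euclidean_space \<Rightarrow> real"
  assumes H: "continuous_on UNIV H"
    and X: "bounded (range X)" and e: "bounded (range e)"
    and S: "\<And>k. S k \<in> eps_subdifferential (e k) (\<lambda>y. ereal (H y)) (X k)"
  shows "bounded (range S)"
proof -
  obtain B where B: "\<And>k. norm (X k) \<le> B"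
    using X by (auto simp: bounded_iff)
  obtain C where C: "\<And>k. \<bar>e k\<bar> \<le> C"
    using e by (auto simp: bounded_iff)
  have "compact (H ` cball 0 (B + 1))"
    using H by (intro compact_continuous_image) (auto intro: continuous_on_subset)
  then obtain M where M: "\<And>y. norm y \<le> B + 1 \<Longrightarrow> \<bar>H y\<bar> \<le> M"
    using compact_imp_bounded by (fastforce simp: bounded_iff)
  have "norm (S k) \<le> 2 * M + C" for k
  proof -
    \<comment> \<open>The choice \<open>sgn\<close> also covers \<open>S k = 0\<close>, where
      \<open>v = 0\<close>.\<close>
    define v where "v = sgn (S k)"
    have v: "S k \<bullet> v = norm (S k)"
      by (cases "S k = 0") (simp_all add: v_def sgn_div_norm dot_square_norm power2_eq_square)
    have "norm v \<le> 1"
      by (simp add: v_def norm_sgn)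
    then have "norm (X k + v) \<le> B + 1"
      using norm_triangle_ineq[of "X k" v] B[of k] by simp
    moreover have "norm (X k) \<le> B + 1"
      using B[of k] by simp
    moreover have "H (X k) + S k \<bullet> v - e k \<le> H (X k + v)"
      using S[of k] by (auto simp: eps_subdifferential_ereal_iff dest: spec[of _ "X k + v"])
    ultimately show ?thesis
      using M[of "X k + v"] M[of "X k"] C[of k] v by linarith
  qed
  then show ?thesis
    by (auto simp: bounded_iff)
qed

section \<open>Decrease of the energy\<close>

lemma sufficient_decrease:
  fixes G H :: "'a::euclidean_space \<Rightarrow> real"
  assumes stop: "G x - G z - u \<bullet> (x - z) \<ge> c * (norm (z - x))\<^sup>2"
    and s: "s \<in> eps_subdifferential (\<rho> * d\<^sup>2) (\<lambda>y. ereal (H y)) x"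
    and us: "dist u s \<le> \<gamma> * d" and "\<gamma> \<ge> 0"
  shows "(G z - H z) + (\<gamma> / 2 + \<rho>) * (norm (z - x))\<^sup>2 + (c - \<gamma> - \<rho>) * (norm (z - x))\<^sup>2
    \<le> (G x - H x) + (\<gamma> / 2 + \<rho>) * d\<^sup>2"
proof -
  have "H x + s \<bullet> (z - x) - \<rho> * d\<^sup>2 \<le> H z"
    using s by (simp add: eps_subdifferential_ereal_iff)
  \<comment> \<open>Young's inequality splits the mismatch between \<open>u\<close> and
    \<open>s\<close> evenly between the old and the new squared step. The old share, together with
    the tolerance of \<open>s\<close>, yields the weight
    \<open>\<gamma> / 2 + \<rho>\<close>.\<close>
  moreover have "(u - s) \<bullet> (z - x) \<le> \<gamma> / 2 * d\<^sup>2 + \<gamma> / 2 * (norm (z - x))\<^sup>2"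
  proof -
    have "(u - s) \<bullet> (z - x) \<le> norm (u - s) * norm (z - x)"
      by (rule norm_cauchy_schwarz)
    also have "\<dots> \<le> \<gamma> * d * norm (z - x)"
      using us by (intro mult_right_mono) (simp_all add: dist_norm)
    also have "\<dots> = \<gamma> / 2 * (2 * d * norm (z - x))"
      by simp
    also have "\<dots> \<le> \<gamma> / 2 * (d\<^sup>2 + (norm (z - x))\<^sup>2)"
      using \<open>\<gamma> \<ge> 0\<close> by (intro mult_left_mono sum_squares_bound) auto
    finally show ?thesis by (simp add: algebra_simps)
  qed
  ultimately show ?thesis
    using stop by (simp add: algebra_simps)
qed

text \<open>The energy decreases and is bounded below, so its successive drops tend to
  \<open>0\<close>; each drop dominates \<open>b\<close> times a squared step. Once the steps
  vanish, \<open>F\<close> inherits the limit of the energy.\<close>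

lemma decseq_energy_limits:
  fixes F :: "nat \<Rightarrow> real"
  assumes "a \<ge> 0" and "b > 0"
    and decrease: "\<And>k. F (Suc k) + a * (D (Suc k))\<^sup>2 + b * (D (Suc k))\<^sup>2 \<le> F k + a * (D k)\<^sup>2"
    and bound: "\<And>k. m \<le> F k"
  shows "decseq (\<lambda>k. F k + a * (D k)\<^sup>2)" and "D \<longlonglongrightarrow> 0" and "convergent F"
proof -
  define E where "E = (\<lambda>k. F k + a * (D k)\<^sup>2)"
  have step: "b * (D (Suc k))\<^sup>2 \<le> E k - E (Suc k)" for k
    using decrease[of k] by (simp add: E_def)
  have "E (Suc k) \<le> E k" for k
    using step[of k] \<open>b > 0\<close> zero_le_power2[of "D (Suc k)"] mult_nonneg_nonneg[of b "(D (Suc k))\<^sup>2"]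
    by linarith
  then have dec: "decseq E"
    by (simp add: decseq_Suc_iff)
  then show "decseq (\<lambda>k. F k + a * (D k)\<^sup>2)"
    by (simp add: E_def)
  have "m \<le> E k" for k
    using bound[of k] \<open>a \<ge> 0\<close> by (simp add: E_def add_increasing2)
  with dec obtain L where L: "E \<longlonglongrightarrow> L"
    using decseq_convergent by blast
  have "(\<lambda>k. (E k - E (Suc k)) / b) \<longlonglongrightarrow> (L - L) / b"
    by (intro tendsto_intros L LIMSEQ_Suc[OF L]) (use \<open>b > 0\<close> in auto)
  then have quotient: "(\<lambda>k. (E k - E (Suc k)) / b) \<longlonglongrightarrow> 0"
    by simp
  have "(D (Suc k))\<^sup>2 \<le> (E k - E (Suc k)) / b" for k
    using step[of k] \<open>b > 0\<close> by (simp add: field_simps)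
  then have "(\<lambda>k. (D (Suc k))\<^sup>2) \<longlonglongrightarrow> 0"
    by (intro tendsto_sandwich[OF _ _ tendsto_const quotient]) auto
  then have D2: "(\<lambda>k. (D k)\<^sup>2) \<longlonglongrightarrow> 0"
    by (rule LIMSEQ_imp_Suc)
  then show "D \<longlonglongrightarrow> 0"
    by simp
  have "(\<lambda>k. E k - a * (D k)\<^sup>2) \<longlonglongrightarrow> L - a * 0"
    by (intro tendsto_intros L D2)
  then show "convergent F"
    by (auto simp: E_def convergent_def)
qed

theorem theorem6p1:
  fixes g h f :: "real ^ 'n \<Rightarrow> ereal"
    and p :: nat
    and G :: "nat \<Rightarrow> real ^ 'n \<Rightarrow> real"
    and T :: "real ^ 'n \<Rightarrow> real ^ 'n \<Rightarrow> real \<Rightarrow> nat \<Rightarrow> real ^ 'n"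
    and \<sigma> lam \<theta> \<rho> \<gamma> :: real
    and \<zeta> :: "nat \<Rightarrow> real"
    and x :: "int \<Rightarrow> real ^ 'n"
  assumes g: "g \<in> Gamma0" and h: "h \<in> Gamma0"
    and f: "f = (\<lambda>y. g y - h y)"
    and f_bounded_below: "(INF y. f y) > -\<infinity>"
    and dom_h: "effective_domain h = UNIV"
    and p: "p \<ge> 1"
    and G_smooth: "\<And>i. i \<in> {1..p} \<Longrightarrow> continuously_differentiable (G i)"
    and G_convex: "\<And>i. i \<in> {1..p} \<Longrightarrow> convex_on UNIV (G i)"
    and g_max: "\<And>y. g y = ereal (Max ((\<lambda>i. G i y) ` {1..p}))"
    and T: "inner_algorithm g T"
    and sigma: "\<sigma> \<in> {0<..<1}"
    and lam: "lam > 0"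
    and theta: "\<theta> > 1 / lam"
    and rho: "\<rho> \<in> {0..<(1 - \<sigma>) / lam}"
    and gamma: "\<gamma> \<in> {0..<(1 - \<sigma>) / lam - \<rho>}"
    and zeta_pos: "\<And>k. \<zeta> k > 0"
    and zeta_lim: "\<zeta> \<longlonglongrightarrow> 0"
    and generated: "tPLDCA_generated p G g h T \<sigma> lam \<theta> \<rho> \<gamma> \<zeta> x"
  shows
    "decseq (\<lambda>k::nat. f (x (int k)) +
        ereal ((\<gamma> / 2 + \<rho>) * (norm (x (int k) - x (int k - 1)))\<^sup>2)) \<and>
     (\<lambda>k::nat. norm (x (int k + 1) - x (int k))) \<longlonglongrightarrow> 0 \<and>
     (\<exists>l::real. (\<lambda>k::nat. f (x (int k))) \<longlonglongrightarrow> ereal l) \<and>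
     (\<forall>xbar. cluster_point xbar (\<lambda>k::nat. x (int k)) \<longrightarrow>
        (\<lambda>k::nat. f (x (int k))) \<longlonglongrightarrow> f xbar \<and>
        critical_point g h xbar)"
proof -

  \<comment> \<open>Reduction to real-valued functions\<close>
  define M where "M = (\<lambda>y. Max ((\<lambda>i. G i y) ` {1..p}))"
  have gM: "g = (\<lambda>y. ereal (M y))"
    by (auto simp: M_def g_max)
  have "effective_domain g = UNIV"
    by (simp add: effective_domain_def gM)
  \<comment> \<open>The real representative obtained here coincides with \<open>M\<close>, as
    \<open>ereal\<close> is injective.\<close>
  from Gamma0_finite_valued[OF g this] have contM: "continuous_on UNIV M"
    by (metis gM ereal.inject ext)
  obtain H where hH: "h = (\<lambda>y. ereal (H y))"
    and convH: "convex_on UNIV H" and contH: "continuous_on UNIV H"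
    by (rule Gamma0_finite_valued[OF h dom_h])
  have f_eq: "f y = ereal (M y - H y)" for y
    by (simp add: f gM hH)
  obtain m where m: "\<And>y. m \<le> M y - H y"
  proof -
    obtain m where "ereal m < (INF y. f y)"
      using f_bounded_below less_ereal.simps ereal_dense2 by blast
    then show ?thesis
      by (intro that[of m])
        (metis INF_lower UNIV_I ereal_less_eq(3) f_eq less_imp_le order_trans)
  qed

  define X where "X = (\<lambda>k. x (int k))"
  \<comment> \<open>\<open>D k\<close> is the length of the step arriving at \<open>X k\<close>, so
    \<open>D 0\<close> involves \<open>x (-1)\<close>; the step leaving \<open>X k\<close> has
    length \<open>D (Suc k)\<close>.\<close>
  define D where "D = (\<lambda>k. norm (x (int k) - x (int k - 1)))"
  define c where "c = (1 - \<sigma>) / lam"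
  have D_Suc: "D (Suc k) = norm (X (Suc k) - X k)" for k
    by (simp add: D_def X_def add.commute)
  have x_next: "x (int k + 1) = X (Suc k)" for k
    by (simp add: X_def add.commute)
  obtain u where step: "\<And>k. infdist (u k)
        (eps_subdifferential (\<rho> * (norm (x (int k) - x (int k - 1)))\<^sup>2) h (x (int k)))
      \<le> \<gamma> * norm (x (int k) - x (int k - 1)) \<and>
      (\<exists>z. stop_test p G g \<sigma> lam \<theta> (\<zeta> k) (x (int k)) (u k) z \<and> x (int k + 1) = z)"
    using generated unfolding tPLDCA_generated_def by blast
  have u: "infdist (u k) (eps_subdifferential (\<rho> * (D k)\<^sup>2) h (X k)) \<le> \<gamma> * D k" for k
    using step[of k] by (simp add: D_def X_def)
  have stop: "stop_test p G g \<sigma> lam \<theta> (\<zeta> k) (X k) (u k) (X (Suc k))" for k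
    using step[of k] unfolding x_next by (simp add: X_def)
  \<comment> \<open>The strict upper bound on \<open>\<gamma>\<close> is what makes the decrease
    coefficient positive.\<close>
  have rho0: "\<rho> \<ge> 0" and gamma0: "\<gamma> \<ge> 0" and c: "c - \<gamma> - \<rho> > 0"
    using rho gamma by (auto simp: c_def)

  have "\<exists>s. s \<in> eps_subdifferential (\<rho> * (D k)\<^sup>2) h (X k) \<and> dist (u k) s \<le> \<gamma> * D k" for k
  proof -
    have nonempty: "eps_subdifferential (\<rho> * (D k)\<^sup>2) h (X k) \<noteq> {}"
      using convH rho0 unfolding hH by (intro eps_subdifferential_ereal_nonempty) simp_all
    have "closed (eps_subdifferential (\<rho> * (D k)\<^sup>2) h (X k))"
      unfolding hH by (rule closed_eps_subdifferential_ereal)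
    from ex_dist_le_of_infdist_le[OF u this nonempty] show ?thesis by blast
  qed
  then obtain S where S: "\<And>k. S k \<in> eps_subdifferential (\<rho> * (D k)\<^sup>2) h (X k)"
    and uS: "\<And>k. dist (u k) (S k) \<le> \<gamma> * D k"
    by metis

  \<comment> \<open>The base point is \<open>X (Suc k)\<close>, unlike for \<open>S k\<close>,
    because the stopping test measures the distance at the accepted inner iterate.\<close>
  have "\<exists>w. w \<in> eps_subdifferential (\<zeta> k) g (X (Suc k)) \<and> dist (u k) w \<le> \<theta> * D (Suc k)" for k
  proof -
    have "G i y \<le> M y" if "i \<in> {1..p}" for i y
      using that by (simp add: M_def)
    then have subset: "strict_eps_subdifferential p G g (\<zeta> k) (X (Suc k))
        \<subseteq> eps_subdifferential (\<zeta> k) g (X (Suc k))"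
      unfolding gM using G_convex G_smooth by (intro strict_eps_subdifferential_subset) auto
    have nonempty: "strict_eps_subdifferential p G g (\<zeta> k) (X (Suc k)) \<noteq> {}"
      by (rule strict_eps_subdifferential_nonempty[OF p less_imp_le[OF zeta_pos] g_max])
    have "infdist (u k) (strict_eps_subdifferential p G g (\<zeta> k) (X (Suc k)))
        \<le> \<theta> * D (Suc k)"
      using stop[of k] by (simp add: stop_test_def D_Suc)
    then obtain w where "w \<in> strict_eps_subdifferential p G g (\<zeta> k) (X (Suc k))"
      "dist (u k) w \<le> \<theta> * D (Suc k)"
      by (rule ex_dist_le_of_infdist_le[OF _ closed_strict_eps_subdifferential nonempty])
    with subset show ?thesis by blast
  qed
  then obtain W where W: "\<And>k. W k \<in> eps_subdifferential (\<zeta> k) g (X (Suc k))"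
    and uW: "\<And>k. dist (u k) (W k) \<le> \<theta> * D (Suc k)"
    by metis

  \<comment> \<open>Energy along the iterates and limits of the whole sequence\<close>
  define F where "F = (\<lambda>k. M (X k) - H (X k))"
  have decrease: "F (Suc k) + (\<gamma> / 2 + \<rho>) * (D (Suc k))\<^sup>2 + (c - \<gamma> - \<rho>) * (D (Suc k))\<^sup>2
      \<le> F k + (\<gamma> / 2 + \<rho>) * (D k)\<^sup>2" for k
  proof -
    have "M (X k) - M (X (Suc k)) - u k \<bullet> (X k - X (Suc k)) \<ge> c * (norm (X (Suc k) - X k))\<^sup>2"
      using stop[of k] by (simp add: stop_test_def gM c_def)
    from sufficient_decrease[OF this S[of k, unfolded hH] uS gamma0] show ?thesis
      by (simp add: F_def D_Suc)
  qed
  have coef: "\<gamma> / 2 + \<rho> \<ge> 0"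
    using rho0 gamma0 by simp
  have F_bound: "m \<le> F k" for k
    by (simp add: F_def m)
  have dec: "decseq (\<lambda>k. F k + (\<gamma> / 2 + \<rho>) * (D k)\<^sup>2)"
    and D_lim: "D \<longlonglongrightarrow> 0" and "convergent F"
    by (fact decseq_energy_limits[where F = F and D = D, OF coef c decrease F_bound])+
  then obtain l where l: "F \<longlonglongrightarrow> l"
    by (auto simp: convergent_def)
  have fF: "f (x (int k)) = ereal (F k)" for k
    by (simp add: f_eq F_def X_def)

  have "decseq (\<lambda>k. f (x (int k)) + ereal ((\<gamma> / 2 + \<rho>) * (norm (x (int k) - x (int k - 1)))\<^sup>2))"
    using dec by (simp add: fF D_def decseq_def)
  moreover have D_Suc_lim: "(\<lambda>k. D (Suc k)) \<longlonglongrightarrow> 0"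
    using D_lim by (rule LIMSEQ_Suc)
  then have "(\<lambda>k. norm (x (int k + 1) - x (int k))) \<longlonglongrightarrow> 0"
    by (simp add: D_Suc x_next) (simp add: X_def)
  moreover have lim_f: "(\<lambda>k. f (x (int k))) \<longlonglongrightarrow> ereal l"
    using l by (simp add: fF)
  moreover have "(\<lambda>k. f (x (int k))) \<longlonglongrightarrow> f xbar \<and> critical_point g h xbar"
    if cluster: "cluster_point xbar (\<lambda>k. x (int k))" for xbar
  proof
    obtain r where r: "strict_mono r" and Xr: "(\<lambda>j. X (r j)) \<longlonglongrightarrow> xbar"
      using cluster by (auto simp: cluster_point_def X_def o_def)
    \<comment> \<open>All of \<open>F\<close> already converges to \<open>l\<close>, so continuity
      along the subsequence suffices to identify \<open>l\<close>.\<close>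
    have "(\<lambda>j. M (X (r j)) - H (X (r j))) \<longlonglongrightarrow> M xbar - H xbar"
      by (intro tendsto_intros continuous_on_tendsto_compose[OF contM Xr]
          continuous_on_tendsto_compose[OF contH Xr]) auto
    moreover have "(\<lambda>j. F (r j)) \<longlonglongrightarrow> l"
      using LIMSEQ_subseq_LIMSEQ[OF l r] by (simp add: o_def)
    ultimately have "l = M xbar - H xbar"
      unfolding F_def using LIMSEQ_unique by blast
    with lim_f show "(\<lambda>k. f (x (int k))) \<longlonglongrightarrow> f xbar"
      by (simp add: f_eq)

    \<comment> \<open>Criticality of the cluster point\<close>
    have "(\<lambda>k. \<rho> * (D k)\<^sup>2) \<longlonglongrightarrow> \<rho> * 0\<^sup>2"
      by (intro tendsto_intros D_lim)
    then have eps: "(\<lambda>k. \<rho> * (D k)\<^sup>2) \<longlonglongrightarrow> 0"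
      by simp
    then have "(\<lambda>j. \<rho> * (D (r j))\<^sup>2) \<longlonglongrightarrow> 0"
      using LIMSEQ_subseq_LIMSEQ[OF _ r] by (fastforce simp: o_def)
    then have bounded_eps: "bounded (range (\<lambda>j. \<rho> * (D (r j))\<^sup>2))"
      by (rule convergent_imp_bounded)
    \<comment> \<open>The restriction to \<open>r\<close> matters: boundedness of the base points
      comes from their convergence along it.\<close>
    have "bounded (range (\<lambda>j. S (r j)))"
      using S unfolding hH
      by (intro bounded_eps_subgradients[OF contH convergent_imp_bounded[OF Xr]
            bounded_eps]) blast
    from bounded_imp_convergent_subsequence[OF this]
    obtain s q where q: "strict_mono q" and Sq: "(\<lambda>j. S (r (q j))) \<longlonglongrightarrow> s"
      by (auto simp: o_def)
    define t where "t = r \<circ> q"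
    have t: "strict_mono t"
      using r q by (simp add: t_def strict_mono_o)
    have St: "(\<lambda>j. S (t j)) \<longlonglongrightarrow> s"
      using Sq by (simp add: t_def)
    have Xt: "(\<lambda>j. X (t j)) \<longlonglongrightarrow> xbar"
      using LIMSEQ_subseq_LIMSEQ[OF Xr q] by (simp add: t_def o_def)
    have along_t: "(\<lambda>j. a (t j)) \<longlonglongrightarrow> L" if "a \<longlonglongrightarrow> L" for a :: "nat \<Rightarrow> real" and L
      using LIMSEQ_subseq_LIMSEQ[OF that t] by (simp add: o_def)

    have "s \<in> subdifferential h xbar"
      unfolding hH
      by (rule eps_subgradients_limit[OF contH Xt St along_t[OF eps]]) (use S hH in auto)
    moreover have "s \<in> subdifferential g xbar"
      unfolding gM
    proof (rule eps_subgradients_limit[OF contM])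
      \<comment> \<open>Vanishing steps carry the limit over to the successors, the base points of
        \<open>W (t j)\<close>.\<close>
      have "(\<lambda>j. X (Suc (t j)) - X (t j)) \<longlonglongrightarrow> 0"
        using along_t[OF D_Suc_lim] by (simp add: D_Suc tendsto_norm_zero_iff)
      from tendsto_add[OF this Xt] show "(\<lambda>j. X (Suc (t j))) \<longlonglongrightarrow> xbar"
        by simp
      \<comment> \<open>Both subgradients are close to the common vector \<open>u k\<close>, so two
        adjacent step lengths control their gap.\<close>
      have WS: "norm (W k - S k) \<le> \<gamma> * D k + \<theta> * D (Suc k)" for k
        using dist_triangle3[of "W k" "S k" "u k"] uS[of k] uW[of k]
        by (simp add: dist_norm)
      have "(\<lambda>k. \<gamma> * D k + \<theta> * D (Suc k)) \<longlonglongrightarrow> \<gamma> * 0 + \<theta> * 0"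
        by (intro tendsto_intros D_lim D_Suc_lim)
      then have "(\<lambda>k. \<gamma> * D k + \<theta> * D (Suc k)) \<longlonglongrightarrow> 0"
        by simp
      then have "(\<lambda>k. W k - S k) \<longlonglongrightarrow> 0"
        by (rule Lim_null_comparison[OF always_eventually[OF allI[OF WS]]])
      then have "(\<lambda>j. W (t j) - S (t j)) \<longlonglongrightarrow> 0"
        using LIMSEQ_subseq_LIMSEQ[OF _ t] by (fastforce simp: o_def)
      from tendsto_add[OF this St] show "(\<lambda>j. W (t j)) \<longlonglongrightarrow> s"
        by simp
      show "(\<lambda>j. \<zeta> (t j)) \<longlonglongrightarrow> 0"
        by (rule along_t[OF zeta_lim])
      show "W (t j) \<in> eps_subdifferential (\<zeta> (t j)) (\<lambda>y. ereal (M y)) (X (Suc (t j)))" for j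
        using W[of "t j"] by (simp add: gM)
    qed
    ultimately show "critical_point g h xbar"
      by (auto simp: critical_point_def)
  qed
  ultimately show ?thesis
    by blast
qed

end
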